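(* Let $n,\ell\ge 1$. Define $\psi:\mathbb{R}^{n\times\ell}\to\mathbb{R}^{\ell\times\ell}$ by $$\psi\left([a_1\ a_2\ \cdots\ a_\ell]\right)=\phi\left([a_1-\overline{a}\ \ a_2-\overline{a}\ \cdots\ a_\ell-\overline{a}]\right),$$ where $\overline{a}=\frac1\ell(a_1+a_2+\cdots+a_\ell)$ is the average of the columns and $\phi(A)=\sqrt{A^{t}A}$. Then $$d_{\mathrm{E}(n)}(A,B)\leq d(\psi(A),\psi(B))\leq\sqrt2\, d_{\mathrm{E}(n)}(A,B)$$ for all $A,B\in\mathbb{R}^{n\times\ell}$. The image of $\psi$ lies in a subspace of $\mathbb{R}^{\ell\times\ell}$ of dimension $\binom{\ell}{2}$.
   Context: On real matrix spaces, $\langle A,B\rangle=\operatorname{trace}(AB^{t})$, $\|A\|=\sqrt{\langle A,A\rangle}$ and $d(A,B)=\|A-B\|$. For a positive semi-definite matrix $M$, $\sqrt{M}$ is the unique positive semi-definite matrix whose square is $M$. The euclidean group $\mathrm{E}(n)$ consists of all pairs $g=(P,q)$ with $P\in\mathrm{O}(n)$, $q\in\mathbb{R}^n$, acting on $\mathbb{R}^n$ by $g\cdot a=Pa+q$, and acting on $\mathbb{R}^{n\times\ell}$ columnwise: $g\cdot[a_1\ \cdots\ a_\ell]=[g\cdot a_1\ \cdots\ g\cdot a_\ell]$. We write $d_{\mathrm{E}(n)}(A,B)=\min_{g\in\mathrm{E}(n)}\|g\cdot A-B\|$. *)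

theory Defs
  imports "HOL-Analysis.Analysis"
begin

text \<open>
  An \<open>n \<times> \<ell>\<close> real matrix is an element of \<^typ>\<open>real ^ 'l ^ 'n\<close> (rows indexed by \<open>'n\<close>, columns by
  \<open>'l\<close>).  The inner product, norm and distance that this type carries in HOL-Analysis are the
  Frobenius ones; this is checked next.
\<close>

lemma inner_matrix_eq_trace:
  fixes A B :: "real ^ 'l ^ 'n"
  shows "A \<bullet> B = trace (A ** transpose B)"
  by (simp add: inner_vec_def trace_def matrix_matrix_mult_def transpose_def)

lemma norm_matrix_eq_sqrt_trace:
  fixes A :: "real ^ 'l ^ 'n"
  shows "norm A = sqrt (trace (A ** transpose A))"
  by (simp add: norm_eq_sqrt_inner inner_matrix_eq_trace)

definition pos_semidef :: "real ^ 'm ^ 'm \<Rightarrow> bool" where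
  "pos_semidef M \<longleftrightarrow> transpose M = M \<and> (\<forall>x. 0 \<le> x \<bullet> (M *v x))"

definition mat_sqrt :: "real ^ 'm ^ 'm \<Rightarrow> real ^ 'm ^ 'm" where
  "mat_sqrt M = (THE S. pos_semidef S \<and> S ** S = M)"

definition euclidean_group :: "((real ^ 'n ^ 'n) \<times> (real ^ 'n)) set" where
  "euclidean_group = {(P, q). orthogonal_matrix P}"

definition euclidean_act :: "(real ^ 'n ^ 'n) \<times> (real ^ 'n) \<Rightarrow> real ^ 'n \<Rightarrow> real ^ 'n" where
  "euclidean_act g a = fst g *v a + snd g"

definition euclidean_act_matrix ::
    "(real ^ 'n ^ 'n) \<times> (real ^ 'n) \<Rightarrow> real ^ 'l ^ 'n \<Rightarrow> real ^ 'l ^ 'n" where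
  "euclidean_act_matrix g A = (\<chi> i j. euclidean_act g (column j A) $ i)"

text \<open>The infimum is a minimum: see \<open>dist_euclidean_attained\<close> below.\<close>

definition dist_euclidean :: "real ^ 'l ^ 'n \<Rightarrow> real ^ 'l ^ 'n \<Rightarrow> real" where
  "dist_euclidean A B = (INF g\<in>euclidean_group. norm (euclidean_act_matrix g A - B))"

definition gram_sqrt :: "real ^ 'l ^ 'n \<Rightarrow> real ^ 'l ^ 'l" where
  "gram_sqrt A = mat_sqrt (transpose A ** A)"

definition column_mean :: "real ^ 'l ^ 'n \<Rightarrow> real ^ 'n" where
  "column_mean A = (1 / real CARD('l)) *\<^sub>R (\<Sum>j\<in>UNIV. column j A)"

definition center_columns :: "real ^ 'l ^ 'n \<Rightarrow> real ^ 'l ^ 'n" where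
  "center_columns A = (\<chi> i j. (column j A - column_mean A) $ i)"

definition centered_gram_sqrt :: "real ^ 'l ^ 'n \<Rightarrow> real ^ 'l ^ 'l" where
  "centered_gram_sqrt A = gram_sqrt (center_columns A)"

lemma column_euclidean_act_matrix:
  "column j (euclidean_act_matrix g A) = euclidean_act g (column j A)"
  by (simp add: euclidean_act_matrix_def column_def vec_eq_iff)

lemma norm_column_le: "norm (column j A) \<le> norm (A :: real ^ 'l ^ 'n)"
proof -
  have "norm (column j A) \<le> norm (\<chi> i. norm (A $ i))"
    by (rule norm_le_componentwise_cart) (simp add: column_def component_le_norm_cart)
  also have "\<dots> = norm A"
    by (simp add: norm_vec_def)
  finally show ?thesis .
qed

lemma norm_orthogonal_matrix_mult:
  assumes "orthogonal_matrix (P :: real ^ 'n ^ 'n)"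
  shows "norm (P *v x) = norm x"
  using assms orthogonal_transformation_matrix[of "(*v) P"]
  by (simp add: orthogonal_transformation_norm)

lemma orthogonal_matrix_norm_le:
  assumes "orthogonal_matrix (P :: real ^ 'n ^ 'n)"
  shows "norm P \<le> sqrt (real CARD('n))"
proof -
  have "P ** transpose P = mat 1"
    using assms by (simp add: orthogonal_matrix_def)
  thus ?thesis
    by (simp add: norm_matrix_eq_sqrt_trace trace_I)
qed

theorem dist_euclidean_attained:
  fixes A B :: "real ^ 'l ^ 'n"
  shows "\<exists>g\<in>euclidean_group. norm (euclidean_act_matrix g A - B) = dist_euclidean A B
           \<and> (\<forall>h\<in>euclidean_group. dist_euclidean A B \<le> norm (euclidean_act_matrix h A - B))"
proof -
  define f where "f g = norm (euclidean_act_matrix g A - B)" for g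
  obtain k :: 'l where True by blast
  define R where "R = norm (A - B) + norm (column k A) + norm (column k B)"
  define K where "K = {P. orthogonal_matrix (P :: real ^ 'n ^ 'n)} \<times> cball (0 :: real ^ 'n) R"
  let ?e = "(mat 1 :: real ^ 'n ^ 'n, 0 :: real ^ 'n)"
  have "closed {P. orthogonal_matrix (P :: real ^ 'n ^ 'n)}"
    unfolding orthogonal_matrix_def matrix_matrix_mult_def transpose_def
    by (intro closed_Collect_conj closed_Collect_eq continuous_intros)
  moreover have "bounded {P. orthogonal_matrix (P :: real ^ 'n ^ 'n)}"
    unfolding bounded_iff using orthogonal_matrix_norm_le by blast
  ultimately have "compact K"
    unfolding K_def by (intro compact_Times compact_cball) (simp add: compact_eq_bounded_closed)
  moreover have eK: "?e \<in> K"
    by (simp add: K_def R_def orthogonal_matrix_id)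
  moreover have "continuous_on K f"
    unfolding f_def euclidean_act_matrix_def euclidean_act_def matrix_vector_mult_def
    by (intro continuous_intros)
  ultimately obtain g where g: "g \<in> K" "\<And>h. h \<in> K \<Longrightarrow> f g \<le> f h"
    using continuous_attains_inf[of K f] by blast
  have fe: "f ?e = norm (A - B)"
    by (simp add: f_def euclidean_act_matrix_def euclidean_act_def column_def)
  have min: "f g \<le> f h" if h: "h \<in> euclidean_group" for h
  proof (cases "h \<in> K")
    case False
    obtain P q where Pq: "h = (P, q)" by fastforce
    with h have P: "orthogonal_matrix P" by (simp add: euclidean_group_def)
    with False Pq have q: "R < norm q" by (simp add: K_def)
    have "column k (euclidean_act_matrix h A - B) = P *v column k A + q - column k B"
      by (simp add: Pq euclidean_act_matrix_def euclidean_act_def column_def vec_eq_iff)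
    hence "norm (P *v column k A + q - column k B) \<le> f h"
      unfolding f_def by (metis norm_column_le)
    moreover have "norm q \<le> norm (P *v column k A + q - column k B) + norm (P *v column k A)
        + norm (column k B)"
      by norm
    ultimately have "f ?e \<le> f h"
      using q by (simp add: fe R_def norm_orthogonal_matrix_mult[OF P])
    thus ?thesis using g(2)[OF eK] by linarith
  qed (use g in simp)
  have gE: "g \<in> euclidean_group"
    using g(1) by (auto simp: K_def euclidean_group_def)
  have "dist_euclidean A B = f g"
    unfolding dist_euclidean_def f_def[symmetric]
    by (rule cInf_eq_minimum) (use gE min in auto)
  thus ?thesis
    using gE min by (auto simp: f_def)
qed

end

theory Submission
  imports Defs
begin

text \<open>
  Write \<open>A v\<^sub>i = s\<^sub>i x\<^sub>i\<close> and \<open>B w\<^sub>j = t\<^sub>j y\<^sub>j\<close> for singular value decompositions of \<open>A\<close> and \<open>B\<close>, so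
  that \<open>\<phi>(A) v\<^sub>i = s\<^sub>i v\<^sub>i\<close> and \<open>\<phi>(B) w\<^sub>j = t\<^sub>j w\<^sub>j\<close>.  Since \<open>\<parallel>\<phi>(A)\<parallel> = \<parallel>A\<parallel>\<close>, both inequalities for
  \<open>\<phi>\<close> compare \<open>\<langle>\<phi>(A), \<phi>(B)\<rangle> = \<Sum> s\<^sub>i t\<^sub>j \<langle>v\<^sub>i, w\<^sub>j\<rangle>\<^sup>2\<close> with
  \<open>\<langle>A, B\<rangle> = \<Sum> s\<^sub>i t\<^sub>j \<langle>v\<^sub>i, w\<^sub>j\<rangle> \<langle>x\<^sub>i, y\<^sub>j\<rangle>\<close>.  The upper bound follows from AM-GM and Bessel's inequality.
  For the lower bound, \<open>\<langle>\<phi>(A), \<phi>(B)\<rangle> = \<langle>C A, B\<rangle>\<close> for the contraction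
  \<open>C = \<Sum> \<langle>v\<^sub>i, w\<^sub>j\<rangle> y\<^sub>j x\<^sub>i\<^sup>t\<close>, and a linear functional on \<open>n \<times> n\<close> matrices is at least as large at some
  orthogonal matrix as at a given contraction.  Centering the columns is an orthogonal
  projection that removes the translations.  Finally \<open>\<psi>(A)\<close> is symmetric and kills the all-ones
  vector, so it is a combination of the Laplacians \<open>(e\<^sub>i - e\<^sub>j)(e\<^sub>i - e\<^sub>j)\<^sup>t\<close>, \<open>i \<noteq> j\<close>.
\<close>

section \<open>Orthonormal families\<close>

text \<open>Families are padded by zero outside \<open>I\<close>, so that singular vectors of zero singular values
  need no separate index set.\<close>

definition orthonormal_on :: "'i set \<Rightarrow> ('i \<Rightarrow> 'a::real_inner) \<Rightarrow> bool" where
  "orthonormal_on I x \<longleftrightarrow> (\<forall>i j. x i \<bullet> x j = of_bool (i = j \<and> i \<in> I))"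

lemma orthonormal_onD: "orthonormal_on I x \<Longrightarrow> x i \<bullet> x j = of_bool (i = j \<and> i \<in> I)"
  by (simp add: orthonormal_on_def)

lemma orthonormal_on_eq_0: "orthonormal_on I x \<Longrightarrow> i \<notin> I \<Longrightarrow> x i = 0"
  using orthonormal_onD[of I x i i] by simp

lemma orthonormal_on_norm: "orthonormal_on I x \<Longrightarrow> i \<in> I \<Longrightarrow> norm (x i) = 1"
  by (simp add: norm_eq_1 orthonormal_onD)

lemma orthonormal_on_norm_le: "orthonormal_on I x \<Longrightarrow> norm (x i) \<le> 1"
  by (cases "i \<in> I") (simp_all add: orthonormal_on_eq_0 orthonormal_on_norm)

lemma orthonormal_on_upd:
  assumes x: "orthonormal_on I x" and u: "norm u = 1" "\<And>i. x i \<bullet> u = 0"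
  shows "orthonormal_on (insert a I) (x(a := u))"
  unfolding orthonormal_on_def
proof (intro allI)
  fix i j
  have "u \<bullet> x i = 0" for i using u(2)[of i] by (simp add: inner_commute)
  thus "(x(a := u)) i \<bullet> (x(a := u)) j = of_bool (i = j \<and> i \<in> insert a I)"
    using u by (auto simp: orthonormal_onD[OF x] norm_eq_1)
qed

text \<open>Only an inequality, because padded indices contribute to the right side but not to the
  left.\<close>

lemma orthonormal_on_comb_norm_le:
  fixes x :: "'i::finite \<Rightarrow> 'a::real_inner"
  assumes x: "orthonormal_on I x"
  shows "(norm (\<Sum>i\<in>UNIV. c i *\<^sub>R x i))\<^sup>2 \<le> (\<Sum>i\<in>UNIV. (c i)\<^sup>2)"
proof -
  have "(norm (\<Sum>i\<in>UNIV. c i *\<^sub>R x i))\<^sup>2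
      = (\<Sum>i\<in>UNIV. \<Sum>j\<in>UNIV. if j = i then (c i)\<^sup>2 * of_bool (i \<in> I) else 0)"
    unfolding power2_norm_eq_inner inner_sum_left inner_sum_right
    by (intro sum.cong refl) (simp add: orthonormal_onD[OF x] power2_eq_square)
  also have "\<dots> = (\<Sum>i\<in>UNIV. (c i)\<^sup>2 * of_bool (i \<in> I))"
    by simp
  also have "\<dots> \<le> (\<Sum>i\<in>UNIV. (c i)\<^sup>2)"
    by (intro sum_mono) simp
  finally show ?thesis .
qed

lemma bessel_inequality:
  fixes x :: "'i::finite \<Rightarrow> 'a::real_inner"
  assumes x: "orthonormal_on I x"
  shows "(\<Sum>i\<in>UNIV. (x i \<bullet> z)\<^sup>2) \<le> (norm z)\<^sup>2"
proof -
  let ?p = "\<Sum>i\<in>UNIV. (x i \<bullet> z) *\<^sub>R x i"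
  have "?p \<bullet> z = (\<Sum>i\<in>UNIV. (x i \<bullet> z)\<^sup>2)"
    by (simp add: inner_sum_left power2_eq_square)
  moreover have "(norm (z - ?p))\<^sup>2 = (norm z)\<^sup>2 - 2 * (?p \<bullet> z) + (norm ?p)\<^sup>2"
    unfolding power2_norm_eq_inner by (simp add: inner_diff_left inner_diff_right inner_commute)
  moreover have "(norm ?p)\<^sup>2 \<le> (\<Sum>i\<in>UNIV. (x i \<bullet> z)\<^sup>2)"
    by (rule orthonormal_on_comb_norm_le[OF x])
  ultimately show ?thesis using zero_le_power2[of "norm (z - ?p)"] by linarith
qed

lemma orthogonal_matrix_of_rows:
  fixes v :: "'m::finite \<Rightarrow> real ^ 'm"
  assumes v: "orthonormal_on UNIV v"
  shows "orthogonal_matrix (\<chi> i. v i)"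
proof -
  have "(\<chi> i. v i) ** transpose (\<chi> i. v i) = (mat 1 :: real ^ 'm ^ 'm)"
    using orthonormal_onD[OF v]
    by (simp add: matrix_matrix_mult_def transpose_def mat_def vec_eq_iff inner_vec_def)
  thus ?thesis
    by (simp add: orthogonal_matrix_def matrix_left_right_inverse)
qed

lemma parseval:
  fixes v :: "'m::finite \<Rightarrow> real ^ 'm"
  assumes v: "orthonormal_on UNIV v"
  shows "(\<Sum>i\<in>UNIV. (v i \<bullet> x) * (v i \<bullet> y)) = x \<bullet> y"
proof -
  define V where "V = (\<chi> i. v i)"
  have "orthogonal_matrix V" unfolding V_def by (rule orthogonal_matrix_of_rows[OF v])
  hence "orthogonal_transformation ((*v) V)"
    by (simp add: orthogonal_transformation_matrix)
  hence "(V *v x) \<bullet> (V *v y) = x \<bullet> y"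
    by (simp add: orthogonal_transformation_def)
  thus ?thesis
    by (simp add: V_def matrix_vector_mult_def inner_vec_def)
qed

lemma orthonormal_expansion:
  fixes v :: "'m::finite \<Rightarrow> real ^ 'm"
  assumes v: "orthonormal_on UNIV v"
  shows "(\<Sum>i\<in>UNIV. (v i \<bullet> x) *\<^sub>R v i) = x"
proof -
  have "(\<Sum>i\<in>UNIV. (v i \<bullet> x) *\<^sub>R v i) \<bullet> z = x \<bullet> z" for z
    using parseval[OF v, of x z] by (simp add: inner_sum_left)
  thus ?thesis using vector_eq_rdot by blast
qed

text \<open>Parseval applied to each row: the Frobenius inner product may be computed in any
  orthonormal basis of the domain, in particular in a singular basis.\<close>

lemma inner_matrix_orthonormal:
  fixes A B :: "real ^ 'l ^ 'n" and v :: "'l \<Rightarrow> real ^ 'l"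
  assumes v: "orthonormal_on UNIV v"
  shows "A \<bullet> B = (\<Sum>i\<in>UNIV. (A *v v i) \<bullet> (B *v v i))"
proof -
  have "A \<bullet> B = (\<Sum>r\<in>UNIV. \<Sum>i\<in>UNIV. (v i \<bullet> A $ r) * (v i \<bullet> B $ r))"
    by (simp add: inner_vec_def[of A B] parseval[OF v])
  also have "\<dots> = (\<Sum>i\<in>UNIV. \<Sum>r\<in>UNIV. (v i \<bullet> A $ r) * (v i \<bullet> B $ r))"
    by (rule sum.swap)
  also have "\<dots> = (\<Sum>i\<in>UNIV. (A *v v i) \<bullet> (B *v v i))"
    by (simp add: inner_vec_def[of "A *v _"] matrix_vector_mul_component inner_commute)
  finally show ?thesis .
qed

lemma matrix_eq_on_orthonormal:
  fixes A B :: "real ^ 'l ^ 'n" and v :: "'l \<Rightarrow> real ^ 'l"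
  assumes v: "orthonormal_on UNIV v" and "\<And>i. A *v v i = B *v v i"
  shows "A = B"
proof -
  have "(A - B) \<bullet> (A - B) = 0"
    using assms by (simp add: inner_matrix_orthonormal[OF v] matrix_vector_mult_diff_rdistrib)
  thus ?thesis by simp
qed

text \<open>An index outside \<open>I\<close> carries the zero vector, so the family spans a proper
  subspace. Basis extension and the spectral theorem both take their next vector from the
  complement.\<close>

lemma orthonormal_on_complement_nontrivial:
  fixes x :: "'m::finite \<Rightarrow> real ^ 'm"
  assumes x: "orthonormal_on I x" and I: "I \<noteq> UNIV"
  shows "{z. \<forall>i. x i \<bullet> z = 0} \<noteq> {0}"
proof -
  obtain a where a: "a \<notin> I" using I by blast
  have "dim (range x) < DIM(real ^ 'm)"
  proof -
    have "range x \<subseteq> insert 0 (x ` (UNIV - {a}))"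
      using orthonormal_on_eq_0[OF x] a by auto
    hence "dim (range x) \<le> dim (x ` (UNIV - {a}))"
      by (metis dim_subset dim_span span_insert_0)
    also have "\<dots> \<le> card (x ` (UNIV - {a}))" by (intro dim_le_card span_superset) auto
    also have "\<dots> \<le> card (UNIV - {a})" by (rule card_image_le) simp
    also have "\<dots> < CARD('m)" by (simp add: card_Diff_singleton)
    finally show ?thesis by simp
  qed
  then obtain z where "z \<noteq> 0" "\<And>y. y \<in> span (range x) \<Longrightarrow> orthogonal z y"
    using orthogonal_to_subspace_exists by blast
  hence "z \<in> {z. \<forall>i. x i \<bullet> z = 0}"
    by (simp add: orthogonal_def inner_commute[of _ z] span_base)
  thus ?thesis using \<open>z \<noteq> 0\<close> by blast
qed

lemma subspace_orthogonal_family: "subspace {z. \<forall>i. x i \<bullet> z = 0}"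
  by (auto simp: subspace_def inner_add_right)

lemma orthonormal_on_extend:
  fixes x :: "'m::finite \<Rightarrow> real ^ 'm"
  assumes "orthonormal_on I x"
  shows "\<exists>y. orthonormal_on UNIV y \<and> (\<forall>i\<in>I. y i = x i)"
  using assms
proof (induction "card (- I)" arbitrary: I x)
  case 0
  hence "I = UNIV" by auto
  thus ?case using 0 by blast
next
  case (Suc k)
  then obtain a where a: "a \<notin> I" by (metis ComplD card.empty equals0I nat.distinct(1))
  then obtain z where z: "\<And>i. x i \<bullet> z = 0" "z \<noteq> 0"
    using orthonormal_on_complement_nontrivial[OF Suc.prems] by fastforce
  have "orthonormal_on (insert a I) (x(a := sgn z))"
    by (rule orthonormal_on_upd[OF Suc.prems]) (use z in \<open>auto simp: norm_sgn sgn_div_norm\<close>)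
  moreover have "k = card (- insert a I)"
    using Suc(2) a by (simp add: Compl_insert card_Diff_singleton)
  ultimately obtain y where "orthonormal_on UNIV y" "\<forall>i\<in>insert a I. y i = (x(a := sgn z)) i"
    using Suc.hyps(1) by blast
  thus ?case using a by (metis fun_upd_other insertI2)
qed

section \<open>Spectral theorem and singular values\<close>

text \<open>The quadratic form \<open>x \<bullet> f x\<close> attains its maximum on the compact
  unit sphere of \<open>S\<close>, and the first-order condition at a maximiser is the eigenvector
  equation.\<close>

lemma self_adjoint_eigenvector:
  fixes f :: "'a::euclidean_space \<Rightarrow> 'a"
  assumes f: "linear f" and sa: "\<And>x y. f x \<bullet> y = x \<bullet> f y"
    and S: "subspace S" "f ` S \<subseteq> S" "S \<noteq> {0}"
  obtains v c where "v \<in> S" "norm v = 1" "f v = c *\<^sub>R v"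
proof -
  let ?K = "S \<inter> sphere 0 1"
  obtain z where "z \<in> S" "z \<noteq> 0" using S subspace_0 by blast
  hence "sgn z \<in> ?K" using S(1) by (auto simp: norm_sgn sgn_div_norm subspace_scale)
  moreover have "compact ?K" by (intro closed_Int_compact closed_subspace S compact_sphere)
  moreover have "continuous_on ?K (\<lambda>x. x \<bullet> f x)"
    using f by (intro continuous_intros linear_continuous_on) (simp add: linear_linear)
  ultimately obtain v where v: "v \<in> ?K" "\<And>x. x \<in> ?K \<Longrightarrow> x \<bullet> f x \<le> v \<bullet> f v"
    using continuous_attains_sup[of ?K] by blast
  define c where "c = v \<bullet> f v"
  \<comment> \<open>\<open>g\<close> is nonnegative on \<open>S\<close> and vanishes at \<open>v\<close>, so its derivative at \<open>v\<close> along \<open>f v - c v\<close> is zero.\<close>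
  define g where "g x = c * (x \<bullet> x) - x \<bullet> f x" for x
  have g_nonneg: "0 \<le> g x" if "x \<in> S" for x
  proof (cases "x = 0")
    case False
    have "sgn x \<in> ?K" using that False S(1) by (auto simp: norm_sgn sgn_div_norm subspace_scale)
    hence "sgn x \<bullet> f (sgn x) \<le> c" using v(2) c_def by blast
    hence "(x \<bullet> f x) / (norm x)\<^sup>2 \<le> c"
      by (simp add: sgn_div_norm linear_cmul[OF f] power2_eq_square divide_inverse mult_ac)
    thus ?thesis using False by (simp add: g_def divide_simps power2_norm_eq_inner)
  qed (simp add: g_def)
  have gv: "g v = 0" using v(1) by (simp add: g_def c_def norm_eq_1)
  define w where "w = f v - c *\<^sub>R v"
  have w: "w \<in> S" unfolding w_def using v(1) S by (intro subspace_diff subspace_scale) auto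
  have quad: "0 \<le> - 2 * t * (w \<bullet> w) + t\<^sup>2 * g w" for t
  proof -
    have "g (v + t *\<^sub>R w) = g v + 2 * t * (c * (v \<bullet> w) - f v \<bullet> w) + t\<^sup>2 * g w"
      using sa[of v w] by (simp add: g_def linear_add[OF f] linear_cmul[OF f] inner_add_left
          inner_add_right inner_commute power2_eq_square algebra_simps)
    also have "c * (v \<bullet> w) - f v \<bullet> w = - (w \<bullet> w)"
      by (simp add: w_def inner_diff_left inner_diff_right algebra_simps)
    finally show ?thesis
      using g_nonneg[of "v + t *\<^sub>R w"] v(1) w S(1) gv by (simp add: subspace_add subspace_scale)
  qed
  have "w \<bullet> w \<le> 0"
  proof (rule ccontr)
    assume "\<not> w \<bullet> w \<le> 0"
    hence p: "0 < w \<bullet> w" by linarith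
    \<comment> \<open>The step is short enough that the quadratic term of \<open>quad\<close> is at
      most \<open>t * (w \<bullet> w)\<close>, so the linear term wins; the summand 1 keeps the
      denominator positive.\<close>
    define t where "t = (w \<bullet> w) / (1 + g w)"
    have g: "0 \<le> g w" by (rule g_nonneg[OF w])
    hence t: "0 < t" "t * g w \<le> w \<bullet> w" using p by (simp_all add: t_def field_simps)
    have "t * (t * g w) \<le> t * (w \<bullet> w)" using t by (intro mult_left_mono) auto
    hence "t * (w \<bullet> w) \<le> 0" using quad[of t] by (simp add: power2_eq_square mult_ac)
    thus False using p t by (simp add: mult_le_0_iff)
  qed
  hence "w = 0" by (metis inner_ge_zero inner_eq_zero_iff order_antisym)
  hence "f v = c *\<^sub>R v" by (simp add: w_def)
  thus thesis using v(1) by (auto intro: that)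
qed

lemma symmetric_inner:
  fixes M :: "real ^ 'm ^ 'm"
  assumes "transpose M = M"
  shows "(M *v x) \<bullet> y = x \<bullet> (M *v y)"
  by (metis assms dot_lmul_matrix vector_transpose_matrix)

text \<open>Induction on the set of filled indices: the complement of a family of eigenvectors is
  invariant by symmetry, hence contains another eigenvector. The zero padding satisfies the
  eigenvector equation trivially.\<close>

theorem spectral_theorem_symmetric:
  fixes M :: "real ^ 'm ^ 'm"
  assumes M: "transpose M = M"
  obtains v :: "'m \<Rightarrow> real ^ 'm" and c where "orthonormal_on UNIV v" "\<And>i. M *v v i = c i *\<^sub>R v i"
proof -
  have "\<exists>v. orthonormal_on J v \<and> (\<forall>i. \<exists>c. M *v v i = c *\<^sub>R v i)" if "finite J" for J :: "'m set"
    using that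
  proof (induction J)
    case empty
    show ?case by (rule exI[of _ "\<lambda>_. 0"]) (simp add: orthonormal_on_def)
  next
    case (insert a J)
    then obtain v where v: "orthonormal_on J v" "\<And>i. \<exists>c. M *v v i = c *\<^sub>R v i" by blast
    let ?S = "{z. \<forall>i. v i \<bullet> z = 0}"
    have "(*v) M ` ?S \<subseteq> ?S"
    proof clarify
      fix z i assume z: "\<forall>i. v i \<bullet> z = 0"
      obtain c where "M *v v i = c *\<^sub>R v i" using v by blast
      thus "v i \<bullet> (M *v z) = 0" using z by (simp add: symmetric_inner[OF M, symmetric])
    qed
    moreover have "?S \<noteq> {0}" using orthonormal_on_complement_nontrivial[OF v(1)] insert by blast
    ultimately obtain u c where u: "u \<in> ?S" "norm u = 1" "M *v u = c *\<^sub>R u"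
      using self_adjoint_eigenvector[of "(*v) M" ?S] symmetric_inner[OF M]
        subspace_orthogonal_family[of v] matrix_vector_mul_linear[of M] by metis
    have "orthonormal_on (insert a J) (v(a := u))"
      by (rule orthonormal_on_upd[OF v(1)]) (use u in auto)
    moreover have "\<forall>i. \<exists>c. M *v (v(a := u)) i = c *\<^sub>R (v(a := u)) i" using v u by auto
    ultimately show ?case by blast
  qed
  from this[OF finite] obtain v where v: "orthonormal_on (UNIV :: 'm set) v"
      "\<forall>i. \<exists>c. M *v v i = c *\<^sub>R v i"
    by blast
  then obtain c where "\<And>i. M *v v i = c i *\<^sub>R v i" by metis
  with v show thesis using that by blast
qed

section \<open>Positive semi-definite square roots\<close>

lemma matrix_of_eigenbasis:
  fixes v :: "'m::finite \<Rightarrow> real ^ 'm"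
  assumes v: "orthonormal_on UNIV v" and s: "\<And>i. 0 \<le> s i"
  obtains S where "pos_semidef S" "\<And>i. S *v v i = s i *\<^sub>R v i"
proof -
  \<comment> \<open>The spectral sum of the matrices \<open>s i\<close> times \<open>v i\<close>
    \<open>v i\<close>^t.\<close>
  define S :: "real ^ 'm ^ 'm" where "S = (\<chi> p q. \<Sum>i\<in>UNIV. s i * (v i $ p * v i $ q))"
  have S: "S *v z = (\<Sum>i\<in>UNIV. (s i * (v i \<bullet> z)) *\<^sub>R v i)" for z
  proof (subst vec_eq_iff, rule allI)
    fix p
    have "(S *v z) $ p = (\<Sum>q\<in>UNIV. \<Sum>i\<in>UNIV. s i * (v i $ p * v i $ q) * z $ q)"
      by (simp add: S_def matrix_vector_mult_def sum_distrib_right)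
    also have "\<dots> = (\<Sum>i\<in>UNIV. \<Sum>q\<in>UNIV. s i * (v i $ p * v i $ q) * z $ q)"
      by (rule sum.swap)
    also have "\<dots> = (\<Sum>i\<in>UNIV. (s i * (v i \<bullet> z)) *\<^sub>R v i) $ p"
      by (simp add: inner_vec_def sum_distrib_left sum_distrib_right mult_ac)
    finally show "(S *v z) $ p = (\<Sum>i\<in>UNIV. (s i * (v i \<bullet> z)) *\<^sub>R v i) $ p" .
  qed
  have "transpose S = S"
    by (simp add: S_def transpose_def vec_eq_iff mult_ac)
  moreover have "0 \<le> z \<bullet> (S *v z)" for z
    unfolding S inner_sum_right using s
    by (intro sum_nonneg) (simp add: inner_commute mult.assoc)
  moreover have "S *v v j = s j *\<^sub>R v j" for j
  proof -
    have "S *v v j = (\<Sum>i\<in>UNIV. if i = j then s j *\<^sub>R v j else 0)"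
      unfolding S by (intro sum.cong) (auto simp: orthonormal_onD[OF v])
    thus ?thesis by simp
  qed
  ultimately show thesis using that pos_semidef_def by blast
qed

text \<open>This gives uniqueness of the square root. For \<open>w\<close> = (S - c) v the
  hypothesis reads (S + c) w = 0, and positivity of \<open>S\<close> excludes the eigenvalue -c for
  nonzero \<open>w\<close> when c > 0. For c = 0, the squared norm of S v is the inner product of v
  with S (S v).\<close>

lemma pos_semidef_square_eigenvector:
  assumes S: "pos_semidef S" and c: "0 \<le> c" and v: "S *v (S *v v) = c\<^sup>2 *\<^sub>R v"
  shows "S *v v = c *\<^sub>R v"
proof (cases "c = 0")
  case True
  have "(S *v v) \<bullet> (S *v v) = v \<bullet> (S *v (S *v v))"
    using S symmetric_inner pos_semidef_def by blast
  thus ?thesis using v True by simp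
next
  case False
  define w where "w = S *v v - c *\<^sub>R v"
  have "S *v w = - (c *\<^sub>R w)"
    using v by (simp add: w_def matrix_vector_mult_diff_distrib matrix_vector_mult_scaleR
        scaleR_right_diff_distrib power2_eq_square)
  moreover have "0 \<le> w \<bullet> (S *v w)" using S pos_semidef_def by blast
  ultimately have "c * (w \<bullet> w) \<le> 0" by simp
  moreover have "0 < c" using False c by simp
  ultimately have "w \<bullet> w \<le> 0" by (simp add: mult_le_0_iff)
  hence "w = 0" by (metis inner_ge_zero inner_eq_zero_iff order_antisym)
  thus ?thesis by (simp add: w_def)
qed

lemma mat_sqrt_eigenbasis:
  fixes v :: "'m::finite \<Rightarrow> real ^ 'm"
  assumes v: "orthonormal_on UNIV v" and s: "\<And>i. 0 \<le> s i"
    and M: "\<And>i. M *v v i = (s i)\<^sup>2 *\<^sub>R v i"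
  shows "mat_sqrt M *v v i = s i *\<^sub>R v i"
proof -
  obtain S where S: "pos_semidef S" "\<And>i. S *v v i = s i *\<^sub>R v i"
    using matrix_of_eigenbasis[of v s] v s by blast
  have "S ** S = M"
    by (rule matrix_eq_on_orthonormal[OF v])
      (simp add: S M matrix_vector_mul_assoc[symmetric] matrix_vector_mult_scaleR power2_eq_square)
  moreover have "T = S" if T: "pos_semidef T" "T ** T = M" for T
  proof (rule matrix_eq_on_orthonormal[OF v])
    fix i
    have "T *v (T *v v i) = (s i)\<^sup>2 *\<^sub>R v i" by (simp add: matrix_vector_mul_assoc T M)
    from pos_semidef_square_eigenvector[OF T(1) s this] show "T *v v i = S *v v i" by (simp add: S)
  qed
  ultimately have "(THE T. pos_semidef T \<and> T ** T = M) = S"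
    using S(1) by blast
  hence "mat_sqrt M = S" by (simp add: mat_sqrt_def)
  thus ?thesis by (simp add: S)
qed

section \<open>Singular value decomposition\<close>

lemma inner_transpose_mult:
  fixes A :: "real ^ 'l ^ 'n"
  shows "x \<bullet> ((transpose A ** A) *v y) = (A *v x) \<bullet> (A *v y)"
proof -
  have "x \<bullet> (transpose A *v (A *v y)) = (x v* transpose A) \<bullet> (A *v y)"
    by (rule dot_lmul_matrix[symmetric])
  thus ?thesis
    by (simp add: matrix_vector_mul_assoc[symmetric] vector_transpose_matrix)
qed

text \<open>Everything is indexed by columns. The left vectors \<open>x\<close> vanish where
  \<open>s\<close> does, so the sizes of \<open>'l\<close> and \<open>'n\<close> need not be
  compared.\<close>

definition singular_system ::
    "real ^ 'l ^ 'n \<Rightarrow> ('l \<Rightarrow> real ^ 'l) \<Rightarrow> ('l \<Rightarrow> real) \<Rightarrow> ('l \<Rightarrow> real ^ 'n) \<Rightarrow> bool" where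
  "singular_system A v s x \<longleftrightarrow> orthonormal_on UNIV v \<and> (\<forall>i. 0 \<le> s i)
     \<and> orthonormal_on {i. s i \<noteq> 0} x \<and> (\<forall>i. A *v v i = s i *\<^sub>R x i)"

lemma singular_systemD:
  assumes "singular_system A v s x"
  shows "orthonormal_on UNIV v" "0 \<le> s i" "orthonormal_on {i. s i \<noteq> 0} x" "A *v v i = s i *\<^sub>R x i"
  using assms by (simp_all add: singular_system_def)

lemma gram_sqrt_singular_system:
  assumes "singular_system A v s x"
  shows "gram_sqrt A *v v i = s i *\<^sub>R v i"
  unfolding gram_sqrt_def
proof (rule mat_sqrt_eigenbasis)
  note A = singular_systemD[OF assms]
  show "orthonormal_on UNIV v" "0 \<le> s j" for j by (rule A)+
  show "(transpose A ** A) *v v j = (s j)\<^sup>2 *\<^sub>R v j" for j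
  \<comment> \<open>Testing against \<open>z\<close> expanded in the basis \<open>v\<close> leaves
    only inner products of the mutually orthogonal vectors \<open>A *v v i\<close>.\<close>
  proof (subst vector_eq_rdot[symmetric], rule allI)
    fix z
    have "((transpose A ** A) *v v j) \<bullet> z
        = (\<Sum>i\<in>UNIV. (v i \<bullet> z) *\<^sub>R v i) \<bullet> ((transpose A ** A) *v v j)"
      by (simp add: orthonormal_expansion[OF A(1)] inner_commute[of "(transpose A ** A) *v v j"])
    also have "\<dots> = (\<Sum>i\<in>UNIV. (v i \<bullet> z) * ((A *v v i) \<bullet> (A *v v j)))"
      unfolding inner_sum_left by (simp add: inner_transpose_mult matrix_vector_mult_scaleR)
    also have "\<dots> = (\<Sum>i\<in>UNIV. if i = j then (v j \<bullet> z) * (s j)\<^sup>2 else 0)"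
      by (intro sum.cong refl) (simp add: A(4) orthonormal_onD[OF A(3)] power2_eq_square)
    also have "\<dots> = (s j)\<^sup>2 *\<^sub>R v j \<bullet> z" by simp
    finally show "((transpose A ** A) *v v j) \<bullet> z = (s j)\<^sup>2 *\<^sub>R v j \<bullet> z" .
  qed
qed

text \<open>Diagonalise A^t A. The images of its eigenvectors under \<open>A\<close> are pairwise
  orthogonal, with the eigenvalues as squared lengths; normalise the nonzero ones.\<close>

theorem ex_singular_system:
  fixes A :: "real ^ 'l ^ 'n"
  shows "\<exists>v s x. singular_system A v s x"
proof -
  let ?M = "transpose A ** A"
  have "transpose ?M = ?M"
    by (metis matrix_transpose_mul transpose_transpose)
  then obtain v :: "'l \<Rightarrow> real ^ 'l" and c
    where v: "orthonormal_on UNIV v" and c: "\<And>i. ?M *v v i = c i *\<^sub>R v i"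
    using spectral_theorem_symmetric by blast
  have Av: "(A *v v i) \<bullet> (A *v v j) = c i * of_bool (i = j)" for i j
    using inner_transpose_mult[of "v i" A "v j"] orthonormal_onD[OF v, of i j] by (auto simp: c)
  have c0: "0 \<le> c i" for i using Av[of i i] by (metis inner_ge_zero mult_1_right of_bool_eq(2))
  define s where "s i = sqrt (c i)" for i
  \<comment> \<open>Since \<open>inverse 0 = 0\<close>, this is automatically zero where
    \<open>s i = 0\<close>, as the padding requires.\<close>
  define x where "x i = inverse (s i) *\<^sub>R (A *v v i)" for i
  have s: "0 \<le> s i" "(s i)\<^sup>2 = c i" for i using c0 by (simp_all add: s_def)
  have "orthonormal_on {i. s i \<noteq> 0} x"
    unfolding orthonormal_on_def x_def
    by (auto simp: Av s(2)[symmetric] power2_eq_square field_simps)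
  moreover have "A *v v i = s i *\<^sub>R x i" for i
  proof (cases "s i = 0")
    case True
    hence "(A *v v i) \<bullet> (A *v v i) = 0" using Av[of i i] s(2)[of i] by simp
    thus ?thesis by (simp add: True)
  qed (simp add: x_def)
  ultimately have "singular_system A v s x" using v s(1) by (simp add: singular_system_def)
  thus ?thesis by blast
qed

section \<open>Comparison of the distances modulo orthogonal maps\<close>

lemma matrix_vector_mult_expansion:
  fixes B :: "real ^ 'l ^ 'n" and w :: "'l \<Rightarrow> real ^ 'l"
  assumes w: "orthonormal_on UNIV w" and B: "\<And>j. B *v w j = t j *\<^sub>R y j"
  shows "B *v z = (\<Sum>j\<in>UNIV. (t j * (w j \<bullet> z)) *\<^sub>R y j)"
proof -
  have "B *v z = B *v (\<Sum>j\<in>UNIV. (w j \<bullet> z) *\<^sub>R w j)"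
    by (simp add: orthonormal_expansion[OF w])
  also have "\<dots> = (\<Sum>j\<in>UNIV. (w j \<bullet> z) *\<^sub>R (B *v w j))"
    by (simp add: linear_sum[OF matrix_vector_mul_linear] matrix_vector_mult_scaleR)
  finally show ?thesis by (simp add: B mult.commute)
qed

section \<open>The upper bound with the factor sqrt 2\<close>

lemma norm_square_singular_values:
  fixes A :: "real ^ 'l ^ 'n" and v :: "'l \<Rightarrow> real ^ 'l"
  assumes v: "orthonormal_on UNIV v" and x: "orthonormal_on {i. s i \<noteq> 0} x"
    and A: "\<And>i. A *v v i = s i *\<^sub>R x i"
  shows "(norm A)\<^sup>2 = (\<Sum>i\<in>UNIV. (s i)\<^sup>2)"
proof -
  have "(A *v v i) \<bullet> (A *v v i) = (s i)\<^sup>2" for i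
    using orthonormal_onD[OF x, of i i] by (simp add: A power2_eq_square)
  thus ?thesis by (simp add: power2_norm_eq_inner inner_matrix_orthonormal[OF v, of A A])
qed

text \<open>Both squared norms are the sum of the squared singular values. Squared distances can
  therefore be compared through inner products alone.\<close>

lemma norm_gram_sqrt:
  fixes A :: "real ^ 'l ^ 'n"
  shows "norm (gram_sqrt A) = norm A"
proof -
  obtain v s x where sysA: "singular_system A v s x"
    using ex_singular_system by blast
  note v = singular_systemD(1)[OF sysA] and s = singular_systemD(2)[OF sysA]
    and x = singular_systemD(3)[OF sysA]
    and A = singular_systemD(4)[OF sysA] gram_sqrt_singular_system[OF sysA]
  have "(norm (gram_sqrt A))\<^sup>2 = (\<Sum>i\<in>UNIV. (s i)\<^sup>2)"
    unfolding power2_norm_eq_inner inner_matrix_orthonormal[OF v]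
    by (simp add: A orthonormal_onD[OF v] power2_eq_square)
  hence "(norm (gram_sqrt A))\<^sup>2 = (norm A)\<^sup>2"
    using norm_square_singular_values[OF v x A(1)] by simp
  thus ?thesis by simp
qed

text \<open>After expanding the squares and using \<open>norm_gram_sqrt\<close>, this is half of the
  squared inequality in \<open>dist_gram_sqrt_le\<close>.\<close>

lemma inner_le_gram_sqrt:
  fixes A B :: "real ^ 'l ^ 'n"
  shows "2 * (A \<bullet> B) \<le> gram_sqrt A \<bullet> gram_sqrt B + ((norm A)\<^sup>2 + (norm B)\<^sup>2) / 2"
proof -
  obtain v s x where sysA: "singular_system A v s x"
    using ex_singular_system by blast
  note v = singular_systemD(1)[OF sysA] and s = singular_systemD(2)[OF sysA]
    and x = singular_systemD(3)[OF sysA]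
    and A = singular_systemD(4)[OF sysA] gram_sqrt_singular_system[OF sysA]
  obtain w t y where sysB: "singular_system B w t y"
    using ex_singular_system by blast
  note w = singular_systemD(1)[OF sysB] and t = singular_systemD(2)[OF sysB]
    and y = singular_systemD(3)[OF sysB]
    and B = singular_systemD(4)[OF sysB] gram_sqrt_singular_system[OF sysB]
  have AB: "A \<bullet> B = (\<Sum>i\<in>UNIV. \<Sum>j\<in>UNIV. s i * t j * (w j \<bullet> v i) * (x i \<bullet> y j))"
    by (simp add: inner_matrix_orthonormal[OF v] A matrix_vector_mult_expansion[OF w B(1)]
        inner_sum_right sum_distrib_left mult_ac)
  have gAB: "gram_sqrt A \<bullet> gram_sqrt B
      = (\<Sum>i\<in>UNIV. \<Sum>j\<in>UNIV. s i * t j * (w j \<bullet> v i)\<^sup>2)"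
    by (simp add: inner_matrix_orthonormal[OF v] A matrix_vector_mult_expansion[OF w B(2)]
        inner_sum_right sum_distrib_left power2_eq_square inner_commute mult_ac)
  \<comment> \<open>Two AM-GM steps, first on \<open>a\<close>, \<open>b\<close> and then on
    \<open>s i\<close>, \<open>t j\<close>. With \<open>a\<close> = \<open>w j \<bullet> v i\<close>
    and \<open>b\<close> = \<open>x i \<bullet> y j\<close>, the first term sums to the inner
    product of the square roots.\<close>
  have bound: "2 * (s i * t j * a * b) \<le> s i * t j * a\<^sup>2 + ((s i)\<^sup>2 * b\<^sup>2 + (t j)\<^sup>2 * b\<^sup>2) / 2"
    for i j a b
  proof -
    have "0 \<le> s i * t j * (a - b)\<^sup>2" "0 \<le> (s i - t j)\<^sup>2 * b\<^sup>2"
      using s t by simp_all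
    hence st: "2 * (s i * t j * a * b) \<le> s i * t j * a\<^sup>2 + s i * t j * b\<^sup>2"
      "2 * (s i * t j * b\<^sup>2) \<le> (s i)\<^sup>2 * b\<^sup>2 + (t j)\<^sup>2 * b\<^sup>2"
      by (simp_all add: power2_eq_square algebra_simps)
    have "p \<le> q + r \<Longrightarrow> 2 * r \<le> u \<Longrightarrow> p \<le> q + u / 2" for p q r u :: real
      by linarith
    from this[OF st] show ?thesis .
  qed
  have "2 * (A \<bullet> B) \<le> (\<Sum>i\<in>UNIV. \<Sum>j\<in>UNIV. s i * t j * (w j \<bullet> v i)\<^sup>2
      + ((s i)\<^sup>2 * (x i \<bullet> y j)\<^sup>2 + (t j)\<^sup>2 * (x i \<bullet> y j)\<^sup>2) / 2)"
    unfolding AB sum_distrib_left by (intro sum_mono bound)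
  also have "\<dots> = gram_sqrt A \<bullet> gram_sqrt B
      + ((\<Sum>i\<in>UNIV. \<Sum>j\<in>UNIV. (s i)\<^sup>2 * (x i \<bullet> y j)\<^sup>2)
       + (\<Sum>i\<in>UNIV. \<Sum>j\<in>UNIV. (t j)\<^sup>2 * (x i \<bullet> y j)\<^sup>2)) / 2"
    by (simp add: gAB sum.distrib sum_divide_distrib[symmetric])
  \<comment> \<open>For fixed \<open>i\<close>, Bessel bounds the sum over \<open>j\<close> by the
    squared norm of \<open>x i\<close>, which is at most 1; what remains is the sum of the squared
    singular values.\<close>
  also have "(\<Sum>i\<in>UNIV. \<Sum>j\<in>UNIV. (s i)\<^sup>2 * (x i \<bullet> y j)\<^sup>2) \<le> (norm A)\<^sup>2"
  proof -
    have "(\<Sum>j\<in>UNIV. (x i \<bullet> y j)\<^sup>2) \<le> 1" for i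
      using bessel_inequality[OF y, of "x i"] orthonormal_on_norm_le[OF x, of i]
      by (simp add: inner_commute) (meson norm_ge_zero order_trans power_le_one)
    hence "(s i)\<^sup>2 * (\<Sum>j\<in>UNIV. (x i \<bullet> y j)\<^sup>2) \<le> (s i)\<^sup>2" for i
      by (simp add: mult_left_le)
    thus ?thesis
      by (auto simp: norm_square_singular_values[OF v x A(1)] sum_distrib_left[symmetric]
          intro!: sum_mono)
  qed
  also have "(\<Sum>i\<in>UNIV. \<Sum>j\<in>UNIV. (t j)\<^sup>2 * (x i \<bullet> y j)\<^sup>2) \<le> (norm B)\<^sup>2"
  proof -
    have "(\<Sum>i\<in>UNIV. (x i \<bullet> y j)\<^sup>2) \<le> 1" for j
      using bessel_inequality[OF x, of "y j"] orthonormal_on_norm_le[OF y, of j]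
      by (meson norm_ge_zero order_trans power_le_one)
    hence "(t j)\<^sup>2 * (\<Sum>i\<in>UNIV. (x i \<bullet> y j)\<^sup>2) \<le> (t j)\<^sup>2" for j
      by (simp add: mult_left_le)
    thus ?thesis
      by (subst sum.swap) (auto simp: norm_square_singular_values[OF w y B(1)]
          sum_distrib_left[symmetric] intro!: sum_mono)
  qed
  finally show ?thesis by simp
qed

lemma power2_norm_diff:
  fixes x y :: "'a::real_inner"
  shows "(norm (x - y))\<^sup>2 = (norm x)\<^sup>2 + (norm y)\<^sup>2 - 2 * (x \<bullet> y)"
  by (simp add: power2_norm_eq_inner inner_diff_left inner_diff_right inner_commute)

theorem dist_gram_sqrt_le:
  fixes A B :: "real ^ 'l ^ 'n"
  shows "dist (gram_sqrt A) (gram_sqrt B) \<le> sqrt 2 * norm (A - B)"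
proof (rule power2_le_imp_le)
  show "(dist (gram_sqrt A) (gram_sqrt B))\<^sup>2 \<le> (sqrt 2 * norm (A - B))\<^sup>2"
    using inner_le_gram_sqrt[of A B]
    by (simp add: dist_norm power_mult_distrib power2_norm_diff norm_gram_sqrt field_simps)
qed simp

section \<open>The lower bound: choosing an orthogonal matrix\<close>

lemma gram_sqrt_orthogonal_mult:
  fixes A :: "real ^ 'l ^ 'n"
  assumes "orthogonal_matrix P"
  shows "gram_sqrt (P ** A) = gram_sqrt A"
proof -
  have "transpose (P ** A) ** (P ** A) = transpose A ** ((transpose P ** P) ** A)"
    by (simp only: matrix_transpose_mul matrix_mul_assoc)
  also have "\<dots> = transpose A ** A" using assms by (simp add: orthogonal_matrix_def)
  finally show ?thesis by (simp only: gram_sqrt_def)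
qed

text \<open>With the bases as rows of \<open>V\<close> and \<open>Y\<close>, \<open>V\<close> sends
  \<open>v i\<close> to the standard basis and the transpose of \<open>Y\<close> sends that to
  \<open>y i\<close>.\<close>

lemma orthogonal_matrix_between_bases:
  fixes v y :: "'m::finite \<Rightarrow> real ^ 'm"
  assumes v: "orthonormal_on UNIV v" and y: "orthonormal_on UNIV y"
  obtains P where "orthogonal_matrix P" "\<And>i. P *v v i = y i"
proof -
  define V Y where "V = (\<chi> i. v i)" and "Y = (\<chi> i. y i)"
  have V: "V *v v i = axis i 1" for i
    using orthonormal_onD[OF v]
    by (simp add: V_def matrix_vector_mult_def vec_eq_iff axis_def inner_vec_def)
  have "(transpose Y ** V) *v v i = y i" for i
  proof -
    have "(transpose Y ** V) *v v i = column i (transpose Y)"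
      by (simp only: matrix_vector_mul_assoc[symmetric] V matrix_vector_mult_basis)
    thus ?thesis by (simp add: Y_def transpose_def column_def)
  qed
  moreover have "orthogonal_matrix (transpose Y ** V)"
    unfolding V_def Y_def
    by (intro orthogonal_matrix_mul orthogonal_matrix_of_rows v y)
      (simp add: orthogonal_matrix_transpose orthogonal_matrix_of_rows y)
  ultimately show thesis using that by blast
qed

text \<open>A contraction pairs with \<open>M\<close> to at most the sum of its singular values, and
  an orthogonal matrix carrying right to left singular vectors attains this sum.\<close>

lemma inner_contraction_le_orthogonal:
  fixes C M :: "real ^ 'n ^ 'n"
  assumes C: "\<And>z. norm (C *v z) \<le> norm z"
  obtains P where "orthogonal_matrix P" "C \<bullet> M \<le> P \<bullet> M"
proof -
  obtain v s x where sysM: "singular_system M v s x"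
    using ex_singular_system by blast
  note v = singular_systemD(1)[OF sysM] and s = singular_systemD(2)[OF sysM]
    and x = singular_systemD(3)[OF sysM]
    and M = singular_systemD(4)[OF sysM]
  \<comment> \<open>Since \<open>M\<close> is square, the left vectors extend to a full basis; the
    added ones do not affect the sums, as their weight \<open>s i\<close> is zero.\<close>
  obtain y where y: "orthonormal_on UNIV y" "\<And>i. s i \<noteq> 0 \<Longrightarrow> y i = x i"
    using orthonormal_on_extend[OF x] by auto
  obtain P where P: "orthogonal_matrix P" "\<And>i. P *v v i = y i"
    using orthogonal_matrix_between_bases[OF v y(1)] by blast
  have "C \<bullet> M = (\<Sum>i\<in>UNIV. s i * ((C *v v i) \<bullet> x i))"
    by (simp add: inner_matrix_orthonormal[OF v] M)
  also have "\<dots> \<le> (\<Sum>i\<in>UNIV. s i)"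
  proof (intro sum_mono)
    fix i
    have "(C *v v i) \<bullet> x i \<le> norm (C *v v i) * norm (x i)" by (rule norm_cauchy_schwarz)
    also have "\<dots> \<le> 1 * 1"
      using C[of "v i"] orthonormal_on_norm[OF v, of i] orthonormal_on_norm_le[OF x, of i]
      by (intro mult_mono) auto
    finally show "s i * ((C *v v i) \<bullet> x i) \<le> s i" using s by (simp add: mult_left_le)
  qed
  also have "\<dots> = (\<Sum>i\<in>UNIV. s i * (y i \<bullet> x i))"
  proof (intro sum.cong refl)
    show "s i = s i * (y i \<bullet> x i)" for i
      using y(2)[of i] orthonormal_onD[OF x, of i i] by (cases "s i = 0") auto
  qed
  also have "\<dots> = P \<bullet> M"
    by (simp add: inner_matrix_orthonormal[OF v] M P)
  finally show thesis using that P by blast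
qed

lemma gram_sqrt_inner_contraction:
  fixes A B :: "real ^ 'l ^ 'n"
  obtains C :: "real ^ 'n ^ 'n" where "\<And>z. norm (C *v z) \<le> norm z"
    "gram_sqrt A \<bullet> gram_sqrt B = (C ** A) \<bullet> B"
proof -
  obtain v s x where sysA: "singular_system A v s x"
    using ex_singular_system by blast
  note v = singular_systemD(1)[OF sysA] and s = singular_systemD(2)[OF sysA]
    and x = singular_systemD(3)[OF sysA]
    and A = singular_systemD(4)[OF sysA] gram_sqrt_singular_system[OF sysA]
  obtain w t y where sysB: "singular_system B w t y"
    using ex_singular_system by blast
  note w = singular_systemD(1)[OF sysB] and t = singular_systemD(2)[OF sysB]
    and y = singular_systemD(3)[OF sysB]
    and B = singular_systemD(4)[OF sysB] gram_sqrt_singular_system[OF sysB]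
  \<comment> \<open>\<open>h\<close> sends each nonzero \<open>x i\<close> to \<open>v i\<close>,
    and \<open>f\<close> follows it by the map sending \<open>w j\<close> to \<open>y j\<close>.
    Hence the matrix of \<open>f\<close> is the sum of \<open>(w j \<bullet> v i)\<close>
    \<open>y j\<close> \<open>x i\<close>^t, and each factor is a contraction.\<close>
  define h where "h z = (\<Sum>i\<in>UNIV. (x i \<bullet> z) *\<^sub>R v i)" for z
  define f where "f z = (\<Sum>j\<in>UNIV. (w j \<bullet> h z) *\<^sub>R y j)" for z
  have h: "linear h"
    unfolding h_def
    by (rule linearI) (simp_all add: inner_add_right scaleR_add_left sum.distrib scaleR_sum_right)
  have f: "linear f"
    unfolding f_def
    by (rule linearI) (simp_all add: linear_add[OF h] linear_cmul[OF h] inner_add_right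
        scaleR_add_left sum.distrib scaleR_sum_right)
  have fC: "matrix f *v z = f z" for z
    using f by (simp add: matrix_works)
  have "norm (matrix f *v z) \<le> norm z" for z
  proof (rule power2_le_imp_le)
    have "(norm (f z))\<^sup>2 \<le> (\<Sum>j\<in>UNIV. (w j \<bullet> h z)\<^sup>2)"
      unfolding f_def by (rule orthonormal_on_comb_norm_le[OF y])
    also have "\<dots> \<le> (norm (h z))\<^sup>2" by (rule bessel_inequality[OF w])
    also have "\<dots> \<le> (\<Sum>i\<in>UNIV. (x i \<bullet> z)\<^sup>2)"
      unfolding h_def by (rule orthonormal_on_comb_norm_le[OF v])
    also have "\<dots> \<le> (norm z)\<^sup>2" by (rule bessel_inequality[OF x])
    finally show "(norm (matrix f *v z))\<^sup>2 \<le> (norm z)\<^sup>2" by (simp add: fC)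
  qed simp
  moreover have "(gram_sqrt A *v v i) \<bullet> (gram_sqrt B *v v i) = ((matrix f ** A) *v v i) \<bullet> (B *v v i)"
    for i
  proof -
    have "h (s i *\<^sub>R x i) = (\<Sum>k\<in>UNIV. if k = i then s i *\<^sub>R v i else 0)"
      unfolding h_def by (intro sum.cong refl) (simp add: orthonormal_onD[OF x])
    hence hs: "h (s i *\<^sub>R x i) = s i *\<^sub>R v i" by simp
    have fy: "t j * (f (s i *\<^sub>R x i) \<bullet> y j) = s i * t j * (w j \<bullet> v i)" for j
    proof -
      have "t j * (f (s i *\<^sub>R x i) \<bullet> y j)
          = (\<Sum>k\<in>UNIV. if k = j then s i * t j * (w j \<bullet> v i) else 0)"
        unfolding f_def hs inner_sum_left sum_distrib_left
        by (intro sum.cong refl) (auto simp: orthonormal_onD[OF y])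
      thus ?thesis by simp
    qed
    have "((matrix f ** A) *v v i) \<bullet> (B *v v i) = f (s i *\<^sub>R x i) \<bullet> (B *v v i)"
      by (simp add: matrix_vector_mul_assoc[symmetric] fC A)
    also have "\<dots> = (\<Sum>j\<in>UNIV. (w j \<bullet> v i) * (t j * (f (s i *\<^sub>R x i) \<bullet> y j)))"
      by (simp add: matrix_vector_mult_expansion[OF w B(1)] inner_sum_right mult_ac)
    also have "\<dots> = (\<Sum>j\<in>UNIV. (w j \<bullet> v i) * (s i * t j * (w j \<bullet> v i)))"
      by (simp only: fy)
    also have "\<dots> = (gram_sqrt A *v v i) \<bullet> (gram_sqrt B *v v i)"
      by (simp add: A matrix_vector_mult_expansion[OF w B(2)] inner_sum_right
          sum_distrib_left inner_commute mult_ac)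
    finally show ?thesis by simp
  qed
  hence "gram_sqrt A \<bullet> gram_sqrt B = (matrix f ** A) \<bullet> B"
    by (simp only: inner_matrix_orthonormal[OF v])
  ultimately show thesis using that by blast
qed

text \<open>The norms on the two sides agree, so a larger inner product means a smaller distance: it
  suffices to replace the contraction by an orthogonal matrix.\<close>

theorem dist_gram_sqrt_ge:
  fixes A B :: "real ^ 'l ^ 'n"
  obtains P :: "real ^ 'n ^ 'n" where "orthogonal_matrix P"
    "norm (P ** A - B) \<le> dist (gram_sqrt A) (gram_sqrt B)"
proof -
  obtain C :: "real ^ 'n ^ 'n" where C: "\<And>z. norm (C *v z) \<le> norm z"
    "gram_sqrt A \<bullet> gram_sqrt B = (C ** A) \<bullet> B"
    using gram_sqrt_inner_contraction by blast
  \<comment> \<open>This exhibits the pairing as a linear functional of \<open>Q\<close>, the form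
    to which \<open>inner_contraction_le_orthogonal\<close> applies.\<close>
  have move: "(Q ** A) \<bullet> B = Q \<bullet> (B ** transpose A)" for Q :: "real ^ 'n ^ 'n"
    by (simp add: inner_matrix_eq_trace matrix_transpose_mul matrix_mul_assoc)
  obtain P :: "real ^ 'n ^ 'n" where P: "orthogonal_matrix P"
    "C \<bullet> (B ** transpose A) \<le> P \<bullet> (B ** transpose A)"
    using inner_contraction_le_orthogonal[OF C(1)] by blast
  have "norm (P ** A) = norm A"
    by (metis P(1) gram_sqrt_orthogonal_mult norm_gram_sqrt)
  hence "(norm (P ** A - B))\<^sup>2 \<le> (dist (gram_sqrt A) (gram_sqrt B))\<^sup>2"
    using P(2) C(2) by (simp add: dist_norm power2_norm_diff norm_gram_sqrt move)
  hence "norm (P ** A - B) \<le> dist (gram_sqrt A) (gram_sqrt B)"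
    by (rule power2_le_imp_le) simp
  with P(1) show thesis by (rule that)
qed


section \<open>Centering\<close>

lemma column_center_columns: "column j (center_columns A) = column j A - column_mean A"
  by (simp add: center_columns_def column_def vec_eq_iff)

lemma matrix_eq_columns: "(\<And>j. column j A = column j B) \<Longrightarrow> A = B"
  by (simp add: column_def vec_eq_iff)

lemma column_matrix_mult: "column j (P ** M) = P *v column j M"
  by (simp add: column_def matrix_matrix_mult_def matrix_vector_mult_def vec_eq_iff)

lemma column_diff: "column j (A - B) = column j A - column j (B :: real ^ 'l ^ 'n)"
  by (simp add: column_def vec_eq_iff)

lemma column_mean_diff: "column_mean (A - B) = column_mean A - column_mean B"
  by (simp add: column_mean_def column_diff sum_subtractf scaleR_right_diff_distrib)

lemma center_columns_diff: "center_columns (A - B) = center_columns A - center_columns B"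
  by (rule matrix_eq_columns) (simp add: column_center_columns column_diff column_mean_diff)

lemma column_mean_euclidean_act:
  "column_mean (euclidean_act_matrix g A) = euclidean_act g (column_mean A)"
  by (simp add: column_mean_def column_euclidean_act_matrix euclidean_act_def sum.distrib
      linear_sum[OF matrix_vector_mul_linear] matrix_vector_mult_scaleR scaleR_right_distrib
      sum_constant_scaleR del: sum_constant)

lemma center_columns_euclidean_act:
  "center_columns (euclidean_act_matrix (P, q) A) = P ** center_columns A"
  by (rule matrix_eq_columns)
    (simp add: column_center_columns column_matrix_mult column_mean_euclidean_act
      column_euclidean_act_matrix euclidean_act_def matrix_vector_mult_diff_distrib)

lemma center_columns_mult_one:
  fixes A :: "real ^ 'l ^ 'n"
  shows "center_columns A *v 1 = 0"
  by (simp add: vec_eq_iff matrix_vector_mult_def center_columns_def column_mean_def column_def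
      sum_subtractf)

text \<open>Each row is the orthogonal sum of its centered row and a multiple of the all-ones
  vector, so Pythagoras applies row by row.\<close>

lemma norm_center_columns_le:
  fixes A :: "real ^ 'l ^ 'n"
  shows "norm (center_columns A) \<le> norm A"
proof (rule norm_le_componentwise_cart)
  fix i
  let ?r = "A $ i" and ?c = "center_columns A $ i" and ?m = "column_mean A $ i"
  have "(center_columns A *v 1) $ i = 0" by (simp only: center_columns_mult_one zero_index)
  hence c: "?c \<bullet> 1 = 0" by (simp only: matrix_vector_mul_component)
  have "?r = ?c + ?m *\<^sub>R 1"
    by (simp add: vec_eq_iff center_columns_def column_def)
  hence "(norm ?r)\<^sup>2 = (norm ?c)\<^sup>2 + (norm (?m *\<^sub>R 1 :: real ^ 'l))\<^sup>2"
    using c by (simp only: norm_add_Pythagorean orthogonal_def inner_scaleR_right)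
  hence "(norm ?c)\<^sup>2 \<le> (norm ?r)\<^sup>2" by simp
  thus "norm ?c \<le> norm ?r" by (rule power2_le_imp_le) simp
qed

lemma dist_euclidean_le_centered_gram_sqrt:
  "dist_euclidean A B \<le> dist (centered_gram_sqrt A) (centered_gram_sqrt B)"
proof -
  obtain P where P: "orthogonal_matrix P"
    "norm (P ** center_columns A - center_columns B)
      \<le> dist (centered_gram_sqrt A) (centered_gram_sqrt B)"
    unfolding centered_gram_sqrt_def using dist_gram_sqrt_ge by blast
  \<comment> \<open>The translation moves the mean of \<open>A\<close> to the mean of
    \<open>B\<close>, so only the centered difference remains.\<close>
  let ?g = "(P, column_mean B - P *v column_mean A)"
  have "euclidean_act_matrix ?g A - B = P ** center_columns A - center_columns B"
    by (rule matrix_eq_columns)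
      (simp add: column_diff column_euclidean_act_matrix euclidean_act_def column_matrix_mult
        column_center_columns matrix_vector_mult_diff_distrib)
  moreover have "?g \<in> euclidean_group" using P(1) by (simp add: euclidean_group_def)
  ultimately have "dist_euclidean A B \<le> norm (P ** center_columns A - center_columns B)"
    using dist_euclidean_attained[of A B] by metis
  thus ?thesis using P(2) by linarith
qed

text \<open>For a minimising motion, \<open>P\<close> is invisible to \<open>gram_sqrt\<close>, and
  the centered difference is the centering of the optimal difference, hence no longer than
  it.\<close>

lemma centered_gram_sqrt_le_dist_euclidean:
  "dist (centered_gram_sqrt A) (centered_gram_sqrt B) \<le> sqrt 2 * dist_euclidean A B"
proof -
  obtain P q where g: "(P, q) \<in> euclidean_group"
    "norm (euclidean_act_matrix (P, q) A - B) = dist_euclidean A B"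
    using dist_euclidean_attained[of A B] by auto
  have P: "orthogonal_matrix P" using g(1) by (simp add: euclidean_group_def)
  have "dist (centered_gram_sqrt A) (centered_gram_sqrt B)
      = dist (gram_sqrt (P ** center_columns A)) (gram_sqrt (center_columns B))"
    by (simp add: centered_gram_sqrt_def gram_sqrt_orthogonal_mult[OF P])
  also have "\<dots> \<le> sqrt 2 * norm (P ** center_columns A - center_columns B)"
    by (rule dist_gram_sqrt_le)
  also have "P ** center_columns A - center_columns B
      = center_columns (euclidean_act_matrix (P, q) A - B)"
    by (simp add: center_columns_diff center_columns_euclidean_act)
  also have "norm \<dots> \<le> norm (euclidean_act_matrix (P, q) A - B)"
    by (rule norm_center_columns_le)
  finally show ?thesis using g(2) by simp
qed

section \<open>Symmetry and kernel of the square root\<close>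

lemma gram_sqrt_symmetric:
  fixes A :: "real ^ 'l ^ 'n"
  shows "transpose (gram_sqrt A) = gram_sqrt A"
proof -
  obtain v s x where sys: "singular_system A v s x"
    using ex_singular_system by blast
  \<comment> \<open>The explicit symmetric matrix with the same eigenbasis and eigenvalues must be
    \<open>gram_sqrt A\<close>.\<close>
  obtain S where S: "pos_semidef S" "\<And>i. S *v v i = s i *\<^sub>R v i"
    using matrix_of_eigenbasis singular_systemD(1,2)[OF sys] by metis
  have "gram_sqrt A = S"
    by (rule matrix_eq_on_orthonormal[OF singular_systemD(1)[OF sys]])
      (simp add: S gram_sqrt_singular_system[OF sys])
  thus ?thesis using S(1) by (simp add: pos_semidef_def)
qed

text \<open>Pairing \<open>A *v z\<close> with \<open>x k\<close> isolates
  \<open>s k * (v k \<bullet> z)\<close>, which is also the coefficient of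
  \<open>gram_sqrt A *v z\<close> at \<open>v k\<close>.\<close>

lemma gram_sqrt_mult_eq_0:
  fixes A :: "real ^ 'l ^ 'n"
  assumes "A *v z = 0"
  shows "gram_sqrt A *v z = 0"
proof -
  obtain v s x where sys: "singular_system A v s x"
    using ex_singular_system by blast
  note v = singular_systemD(1)[OF sys] and x = singular_systemD(3)[OF sys]
    and A = singular_systemD(4)[OF sys] gram_sqrt_singular_system[OF sys]
  have coeff: "s k * (v k \<bullet> z) = 0" for k
  proof -
    have "0 = x k \<bullet> (A *v z)" using assms by simp
    also have "\<dots> = (\<Sum>j\<in>UNIV. if j = k then s k * (v k \<bullet> z) else 0)"
      unfolding matrix_vector_mult_expansion[OF v A(1)] inner_sum_right
      by (intro sum.cong refl) (auto simp: orthonormal_onD[OF x])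
    finally show ?thesis by simp
  qed
  show ?thesis
    by (simp only: matrix_vector_mult_expansion[OF v A(2)] coeff scaleR_zero_left sum.neutral_const)
qed

section \<open>Symmetric matrices with zero row sums\<close>

text \<open>Indexing by sets makes an edge unordered, so each is counted once. The diagonal is the
  indicator of \<open>T\<close>, whence injectivity on all sets.\<close>

definition edge_laplacian :: "'l set \<Rightarrow> real ^ 'l ^ 'l" where
  "edge_laplacian T = (\<chi> i j. if i \<in> T \<and> j \<in> T then if i = j then 1 else - 1 else 0)"

lemma edge_laplacian_doubleton:
  assumes "i \<noteq> j"
  shows "edge_laplacian {i, j} $ p $ q
    = (of_bool (i = p) - of_bool (j = p)) * (of_bool (i = q) - of_bool (j = q))"
  using assms by (auto simp: edge_laplacian_def)

lemma inj_edge_laplacian: "inj (edge_laplacian :: 'l::finite set \<Rightarrow> _)"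
proof (rule injI)
  fix S T :: "'l set" assume "edge_laplacian S = edge_laplacian T"
  hence eq: "edge_laplacian S $ i $ i = edge_laplacian T $ i $ i" for i by simp
  have "i \<in> S \<longleftrightarrow> i \<in> T" for i
    using eq[of i] by (simp add: edge_laplacian_def split: if_splits)
  thus "S = T" by blast
qed

text \<open>Among two-element sets, only {a, b} gives a nonzero entry at (a, b), so that entry reads
  off its coefficient.\<close>

lemma independent_edge_laplacians:
  "independent (edge_laplacian ` {T :: 'l::finite set. card T = 2})"
proof -
  let ?P = "{T :: 'l set. card T = 2}"
  have "u (edge_laplacian T) = 0"
    if T: "card T = 2" and u: "(\<Sum>M\<in>edge_laplacian ` ?P. u M *\<^sub>R M) = 0" for u T
  proof -
    obtain a b where ab: "T = {a, b}" "a \<noteq> b" using T by (auto simp: card_2_iff)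
    have "(\<Sum>S\<in>?P. u (edge_laplacian S) *\<^sub>R edge_laplacian S) = 0"
      using u by (simp add: sum.reindex inj_on_subset[OF inj_edge_laplacian])
    hence "(\<Sum>S\<in>?P. u (edge_laplacian S) *\<^sub>R edge_laplacian S) $ a $ b = 0" by simp
    hence "0 = (\<Sum>S\<in>?P. u (edge_laplacian S) * edge_laplacian S $ a $ b)" by simp
    also have "\<dots> = (\<Sum>S\<in>?P. if S = T then - u (edge_laplacian T) else 0)"
    proof (intro sum.cong refl)
      fix S assume "S \<in> ?P"
      hence "a \<in> S \<and> b \<in> S \<longleftrightarrow> S = T"
        using ab by (auto simp: card_2_iff)
      thus "u (edge_laplacian S) * edge_laplacian S $ a $ b
          = (if S = T then - u (edge_laplacian T) else 0)"
        using ab(2) by (auto simp: edge_laplacian_def)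
    qed
    also have "\<dots> = - u (edge_laplacian T)" using T by simp
    finally show ?thesis by simp
  qed
  thus ?thesis by (subst dependent_finite) auto
qed

lemma dim_span_edge_laplacians:
  "dim (span (edge_laplacian ` {T :: 'l::finite set. card T = 2})) = CARD('l) choose 2"
proof -
  have "card (edge_laplacian ` {T :: 'l set. card T = 2}) = card {T :: 'l set. card T = 2}"
    by (rule card_image) (rule inj_on_subset[OF inj_edge_laplacian subset_UNIV])
  also have "\<dots> = CARD('l) choose 2"
    using n_subsets[of "UNIV :: 'l set" 2] by simp
  finally show ?thesis
    by (simp add: dim_span dim_eq_card_independent independent_edge_laplacians)
qed

lemma symmetric_zero_row_sums_in_span:
  fixes S :: "real ^ 'l ^ 'l"
  assumes S: "transpose S = S" "S *v 1 = 0"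
  shows "S \<in> span (edge_laplacian ` {T. card T = 2})"
proof -
  \<comment> \<open>The factor 1/2 compensates for summing over ordered pairs, and the sign for the
    off-diagonal -1. The case \<open>i = j\<close> is separate because
    \<open>edge_laplacian {i}\<close> is not zero.\<close>
  define F where "F i j = (if i = j then 0 else (- S $ i $ j / 2) *\<^sub>R edge_laplacian {i, j})" for i j
  have row: "(\<Sum>j\<in>UNIV. S $ i $ j) = 0" for i
    using S(2) by (simp add: vec_eq_iff matrix_vector_mult_def)
  have sym: "S $ i $ j = S $ j $ i" for i j
    using S(1) by (metis transpose_def vec_lambda_beta)
  have F: "F i j $ p $ q = - S $ i $ j / 2
      * ((of_bool (i = p) - of_bool (j = p)) * (of_bool (i = q) - of_bool (j = q)))" for i j p q
    by (simp add: F_def edge_laplacian_doubleton)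
  have "(\<Sum>i\<in>UNIV. \<Sum>j\<in>UNIV. F i j) $ p $ q = S $ p $ q" for p q
  proof -
    let ?d = "\<lambda>i j. of_bool (i = j) :: real"
    \<comment> \<open>Expands the rank-one formula into four products of Kronecker deltas. The two
      mixed ones each give half of the entry at (p, q); the other two reduce to row sums, which
      vanish.\<close>
    have ring: "- s / 2 * ((a - b) * (c - d))
        = (a * (d * (s / 2)) - a * (c * (s / 2))) + (c * (b * (s / 2)) - b * (d * (s / 2)))"
      for a b c d s :: real
      by (simp add: field_simps)
    have delta: "(\<Sum>i\<in>UNIV. ?d i k * f i) = f k" for k :: 'l and f
    proof -
      have "(\<Sum>i\<in>UNIV. ?d i k * f i) = (\<Sum>i\<in>UNIV. if i = k then f k else 0)"
        by (intro sum.cong) auto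
      thus ?thesis by simp
    qed
    have "(\<Sum>i\<in>UNIV. \<Sum>j\<in>UNIV. F i j) $ p $ q
      = (\<Sum>i\<in>UNIV. \<Sum>j\<in>UNIV. (?d i p * (?d j q * (S $ i $ j / 2)) - ?d i p * (?d i q * (S $ i $ j / 2)))
          + (?d i q * (?d j p * (S $ i $ j / 2)) - ?d j p * (?d j q * (S $ i $ j / 2))))"
      unfolding sum_component F by (intro sum.cong refl ring)
    also have "\<dots> = (\<Sum>i\<in>UNIV. ?d i p * (\<Sum>j\<in>UNIV. ?d j q * (S $ i $ j / 2)))
        - (\<Sum>i\<in>UNIV. ?d i p * (?d i q * (\<Sum>j\<in>UNIV. S $ i $ j / 2)))
        + ((\<Sum>i\<in>UNIV. ?d i q * (\<Sum>j\<in>UNIV. ?d j p * (S $ i $ j / 2)))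
        - (\<Sum>i\<in>UNIV. \<Sum>j\<in>UNIV. ?d j p * (?d j q * (S $ i $ j / 2))))"
      by (simp only: sum.distrib sum_subtractf sum_distrib_left)
    \<comment> \<open>Here a column sum appears; symmetry of \<open>S\<close> turns it into a row
      sum.\<close>
    also have "(\<Sum>i\<in>UNIV. \<Sum>j\<in>UNIV. ?d j p * (?d j q * (S $ i $ j / 2)))
        = (\<Sum>j\<in>UNIV. ?d j p * (?d j q * (\<Sum>i\<in>UNIV. S $ j $ i / 2)))"
      unfolding sum_distrib_left by (subst sum.swap) (simp only: sym)
    finally show ?thesis
      by (simp add: delta sum_divide_distrib[symmetric] row sym[of q p]
          del: sum_of_bool_mult_eq sum_mult_of_bool_eq)
  qed
  hence "S = (\<Sum>i\<in>UNIV. \<Sum>j\<in>UNIV. F i j)"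
    by (simp add: vec_eq_iff)
  also have "\<dots> \<in> span (edge_laplacian ` {T. card T = 2})"
  proof (intro span_sum)
    show "F i j \<in> span (edge_laplacian ` {T. card T = 2})" for i j
    proof (cases "i = j")
      case False
      hence "edge_laplacian {i, j} \<in> edge_laplacian ` {T. card T = 2}" by simp
      thus ?thesis unfolding F_def by (simp only: False if_False span_scale span_base)
    qed (simp add: F_def span_zero)
  qed
  finally show ?thesis .
qed

theorem theorem4:
  shows "(\<forall>A B :: real ^ 'l ^ 'n.
            dist_euclidean A B \<le> dist (centered_gram_sqrt A) (centered_gram_sqrt B)
          \<and> dist (centered_gram_sqrt A) (centered_gram_sqrt B) \<le> sqrt 2 * dist_euclidean A B)
       \<and> (\<exists>V :: (real ^ 'l ^ 'l) set. subspace V \<and> dim V = CARD('l) choose 2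
            \<and> range (centered_gram_sqrt :: real ^ 'l ^ 'n \<Rightarrow> real ^ 'l ^ 'l) \<subseteq> V)"
proof (intro conjI allI exI)
  let ?V = "span (edge_laplacian ` {T :: 'l set. card T = 2})"
  show "range (centered_gram_sqrt :: real ^ 'l ^ 'n \<Rightarrow> real ^ 'l ^ 'l) \<subseteq> ?V"
    unfolding centered_gram_sqrt_def
    by (auto intro!: symmetric_zero_row_sums_in_span gram_sqrt_symmetric gram_sqrt_mult_eq_0
        center_columns_mult_one)
qed (rule dist_euclidean_le_centered_gram_sqrt centered_gram_sqrt_le_dist_euclidean
      subspace_span dim_span_edge_laplacians)+

end
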